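(* Consider the homogeneous Kuramoto model with all-to-all coupling, $\dot\theta=V(\theta)$ on $\mathbb{T}^N$, $V_i(\theta)=\frac{K}{N}\sum_{j=1}^N\sin(\theta_j-\theta_i)$, $K>0$. Eigenvalues and eigenspaces of an equilibrium $\theta^\star$ are those of the Jacobian $DV(\theta^\star)\in\mathbb{R}^{N\times N}$. The following statements hold: (i) A coherent equilibrium $\theta^\star$ has - $\lambda_1=0$ as an eigenvalue, with associated eigenspace $\operatorname{span}\{\underline 1\}$; - $\lambda_2=-K$ as an eigenvalue, with associated eigenspace $\operatorname{span}\{e_2-e_1,\dots,e_j-e_1,\dots,e_N-e_1\}$. (ii) A $1$-partially coherent equilibrium $\theta^\star$ has - $\lambda_1=0$ as an eigenvalue, with associated eigenspace $\operatorname{span}\{\underline 1\}$; - $\lambda_2=K$ as an eigenvalue, with associated eigenspace $\operatorname{span}\{\underline 1-Ne_1\}$; - $\lambda_3=K\frac{2-N}{N}$ as an eigenvalue, with associated eigenspace $\operatorname{span}\{e_3-e_2,\dots,e_j-e_2,\dots,e_N-e_2\}$. (iii) A $J$-partially coherent equilibrium $\theta^\star$, with $J=2,\dots,\lfloor N/2\rfloor$ when $N$ is odd or $J=2,\dots,\lfloor N/2\rfloor-1$ when $N$ is even, has - $\lambda_1=0$ as an eigenvalue, with associated eigenspace $\operatorname{span}\{\underline 1\}$; - $\lambda_2=K$ as an eigenvalue, with associated eigenspace $\operatorname{span}\{\underline 1-\frac{N}{J}(e_1+\cdots+e_J)\}$; - $\lambda_3=K\frac{N-2J}{N}$ as an eigenvalue,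 with associated eigenspace $\operatorname{span}\{e_2-e_1,\dots,e_j-e_1,\dots,e_J-e_1\}$; - $\lambda_4=K\frac{2J-N}{N}$ as an eigenvalue, with associated eigenspace $\operatorname{span}\{e_{J+2}-e_{J+1},\dots,e_j-e_{J+1},\dots,e_N-e_{J+1}\}$. (iv) A $\lfloor N/2\rfloor$-partially coherent equilibrium $\theta^\star$ with $N$ even has - $\lambda_1=0$ as an eigenvalue, with associated eigenspace $\operatorname{span}\{e_2-e_1,\dots,e_{\lfloor N/2\rfloor}-e_1,\,e_{\lfloor N/2\rfloor+1}+e_1,\dots,e_N+e_1\}$; - $\lambda_2=K$ as an eigenvalue, with associated eigenspace $\operatorname{span}\{-e_1-\cdots-e_{\lfloor N/2\rfloor}+e_{\lfloor N/2\rfloor+1}+\cdots+e_N\}$. (v) A general incoherent equilibrium $\theta^\star$ such that there exist two indices $i_0$ and $i_1$ satisfying $\theta^\star_{i_0}-\theta^\star_{i_1}\notin\pi\mathbb{Z}$ has - $\lambda_1=0$ as an eigenvalue, with associated eigenspace given by an $(N-2)$-dimensional subspace; - the eigenvalues $$\lambda_{2,3}=\frac K2\left(1\pm\frac1N\left|\sum_{j=1}^N e^{2\mathrm{i}\theta^\star_j}\right|\right),$$ and both eigenvalues have a one-dimensional associated eigenspace.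
   Context: $\mathbb{T}=\mathbb{R}/2\pi\mathbb{Z}$, $N$ is the number of oscillators, $K>0$ is the coupling strength, $e_1,\dots,e_N$ is the canonical basis of $\mathbb{R}^N$, $\underline 1=(1,\dots,1)\in\mathbb{R}^N$, and $\mathrm{i}=\sqrt{-1}$. Definitions, for $\theta^\star\in\mathbb{T}^N$: - coherent equilibrium: there is $q\in\mathbb{T}$ with $\theta^\star=(q,\dots,q)$; - $J$-partially coherent equilibrium: there are $q\in\mathbb{T}$ and $J\in\{1,\dots,\lfloor N/2\rfloor\}$ with $\theta^\star=(q+\pi,\dots,q+\pi,q,\dots,q)$, where exactly the first $J$ entries are $q+\pi$; - general incoherent equilibrium: $\sum_{j=1}^N e^{\mathrm{i}\theta^\star_j}=0$. All these points are zeros of $V$.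
   Formalization: The claim on λ₂ in (i) is stated for N≥2 and that on λ₃ in (ii) for N≥3 (false for N=1, N=2, where the spans are {0}); in (v) the eigenspaces are one-dimensional if λ₂≠λ₃, and if λ₂=λ₃ (e.g. θ*=(0,2π/3,4π/3)) the common eigenspace has dimension 2. *)

theory Defs
  imports "HOL-Analysis.Analysis" "HOL-Library.Real_Mod"
begin

text \<open>
  The index type \<open>'n\<close> is the set of oscillators, so \<open>N = CARD('n)\<close>. A point of the torus
  (the product of \<open>N\<close> copies of the reals modulo \<open>2\<pi>\<close>) is given by any lift in \<open>real ^ 'n\<close>;
  equality of phases is congruence modulo \<open>2\<pi>\<close>. The vector field is \<open>2\<pi>\<close>-periodic in every
  coordinate, and its Jacobian at a point of the torus is the Jacobian at any lift.
\<close>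

definition kuramoto :: "real \<Rightarrow> real ^ 'n \<Rightarrow> real ^ 'n" where
  "kuramoto K \<theta> = (\<chi> i. K / real CARD('n) * (\<Sum>j\<in>UNIV. sin (\<theta> $ j - \<theta> $ i)))"

definition eigenspace :: "real ^ 'n ^ 'n \<Rightarrow> real \<Rightarrow> (real ^ 'n) set" where
  "eigenspace A c = {v. A *v v = c *\<^sub>R v}"

definition eigenvalue :: "real ^ 'n ^ 'n \<Rightarrow> real \<Rightarrow> bool" where
  "eigenvalue A c \<longleftrightarrow> (\<exists>v. v \<noteq> 0 \<and> A *v v = c *\<^sub>R v)"

definition eigenvalue_with_eigenspace :: "real ^ 'n ^ 'n \<Rightarrow> real \<Rightarrow> (real ^ 'n) set \<Rightarrow> bool" where
  "eigenvalue_with_eigenspace A c E \<longleftrightarrow> eigenvalue A c \<and> eigenspace A c = E"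

definition coherent :: "real ^ 'n \<Rightarrow> bool" where
  "coherent \<theta> \<longleftrightarrow> (\<exists>q. \<forall>i. [\<theta> $ i = q] (rmod (2 * pi)))"

text \<open>
  The type \<open>'n\<close> carries no order; \<open>lab\<close> enumerates the oscillators as \<open>lab 1, \<dots>, lab N\<close>,
  which gives a meaning to the first \<open>J\<close> entries.
\<close>

definition partially_coherent :: "(nat \<Rightarrow> 'n) \<Rightarrow> nat \<Rightarrow> real ^ 'n \<Rightarrow> bool" where
  "partially_coherent lab J \<theta> \<longleftrightarrow>
     J \<in> {1..CARD('n) div 2} \<and>
     (\<exists>q. \<forall>j\<in>{1..CARD('n)}. [\<theta> $ lab j = (if j \<le> J then q + pi else q)] (rmod (2 * pi)))"

definition incoherent :: "real ^ 'n \<Rightarrow> bool" where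
  "incoherent \<theta> \<longleftrightarrow> (\<Sum>j\<in>UNIV. exp (\<i> * complex_of_real (\<theta> $ j))) = 0"

end

theory Submission
  imports Defs
begin

text \<open>
  The Jacobian sends \<open>v\<close> to \<open>K/N \<Sum>\<^sub>j cos (\<theta>\<^sub>j - \<theta>\<^sub>i) (v\<^sub>j - v\<^sub>i)\<close>. If every phase is \<open>q\<close> or \<open>q + \<pi>\<close>, then
  \<open>cos (\<theta>\<^sub>j - \<theta>\<^sub>i) = s\<^sub>i s\<^sub>j\<close> for a sign vector \<open>s\<close> and the Jacobian is \<open>K/N (s s\<^sup>T - S diag s)\<close> with
  \<open>S = \<Sum> s\<^sub>j\<close>, so each eigenvector equation is linear in the single unknown \<open>s \<bullet> v\<close>. If the equilibrium
  is incoherent, the diagonal part vanishes and the Jacobian is \<open>K/N (c c\<^sup>T + d d\<^sup>T)\<close> with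
  \<open>c = cos (\<theta> - \<phi>)\<close>, \<open>d = sin (\<theta> - \<phi>)\<close> for any \<open>\<phi>\<close>. Taking \<open>2\<phi>\<close> to be the argument of
  \<open>\<Sum> exp (2 i \<theta>\<^sub>j)\<close> makes \<open>c\<close> and \<open>d\<close> orthogonal, with squared norms \<open>(N \<plusminus> |\<Sum> exp (2 i \<theta>\<^sub>j)|)/2\<close>.
\<close>

section \<open>The Jacobian of the vector field and spans of basis differences\<close>

lemma kuramoto_has_derivative:
  "(kuramoto K has_derivative
     (\<lambda>v. \<chi> i. K / real CARD('n) * (\<Sum>j\<in>UNIV. cos (\<theta> $ j - \<theta> $ i) * (v $ j - v $ i))))
   (at (\<theta> :: real ^ 'n::finite))"
proof -
  have nth: "((\<lambda>x. x $ i) has_derivative (\<lambda>v. v $ i)) (at \<theta>)" for i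
    by (intro bounded_linear_imp_has_derivative bounded_linear_vec_nth)
  have "((\<lambda>x. sin (x $ j - x $ i)) has_derivative (\<lambda>v. cos (\<theta> $ j - \<theta> $ i) * (v $ j - v $ i))) (at \<theta>)"
    for i j
    by (rule has_derivative_eq_rhs, rule has_derivative_sin, rule has_derivative_diff[OF nth nth])
      (simp add: fun_eq_iff mult.commute)
  then have "((\<lambda>x. K / real CARD('n) * (\<Sum>j\<in>UNIV. sin (x $ j - x $ i))) has_derivative
      (\<lambda>v. K / real CARD('n) * (\<Sum>j\<in>UNIV. cos (\<theta> $ j - \<theta> $ i) * (v $ j - v $ i)))) (at \<theta>)" for i
    by (intro has_derivative_mult_right has_derivative_sum)
  then show ?thesis
    unfolding kuramoto_def
    by (subst has_derivative_componentwise_within) (auto simp: Basis_vec_def inner_axis)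
qed

text \<open>\<open>jacobian\<close> is built from a chosen derivative, so the explicit map is
  identified with it by uniqueness of derivatives.\<close>

lemma jacobian_kuramoto:
  fixes \<theta> v :: "real ^ 'n::finite"
  shows "jacobian (kuramoto K) (at \<theta>) *v v =
    (\<chi> i. K / real CARD('n) * (\<Sum>j\<in>UNIV. cos (\<theta> $ j - \<theta> $ i) * (v $ j - v $ i)))"
proof -
  note D = kuramoto_has_derivative[of K \<theta>]
  have "kuramoto K differentiable (at \<theta>)"
    using D by (rule differentiableI)
  then have "(kuramoto K has_derivative (\<lambda>h. jacobian (kuramoto K) (at \<theta>) *v h)) (at \<theta>)"
    by (simp add: jacobian_works)
  from fun_cong[OF has_derivative_unique[OF this D]] show ?thesis .
qed

lemma eigenvalue_with_eigenspaceI: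
  assumes "eigenspace A c = E" "u \<in> E" "u \<noteq> 0"
  shows "eigenvalue_with_eigenspace A c E"
  using assms unfolding eigenvalue_with_eigenspace_def eigenvalue_def eigenspace_def by blast

text \<open>The coordinates on \<open>B\<close> are free and determine the one at \<open>a\<close>,
  so this is the natural basis of a weighted hyperplane. Weights 1 and -1 admit differences and sums
  in one family, as the balanced case requires.\<close>

lemma span_axis_differences:
  fixes w :: "'n::finite \<Rightarrow> real"
  assumes "a \<notin> B"
  shows "span ((\<lambda>i. axis i 1 - w i *\<^sub>R axis a 1) ` B) =
    {v :: real ^ 'n. (\<forall>i. i \<notin> insert a B \<longrightarrow> v $ i = 0) \<and> v $ a + (\<Sum>i\<in>B. w i * v $ i) = 0}"
    (is "span (?f ` B) = ?S")
proof
  have "subspace ?S"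
  proof (rule subspaceI)
    fix x y :: "real ^ 'n" assume "x \<in> ?S" "y \<in> ?S"
    moreover have "(x + y) $ a + (\<Sum>i\<in>B. w i * (x + y) $ i) =
        (x $ a + (\<Sum>i\<in>B. w i * x $ i)) + (y $ a + (\<Sum>i\<in>B. w i * y $ i))"
      by (simp add: distrib_left sum.distrib)
    ultimately show "x + y \<in> ?S" by simp
  next
    fix c and x :: "real ^ 'n" assume "x \<in> ?S"
    moreover have "(c *\<^sub>R x) $ a + (\<Sum>i\<in>B. w i * (c *\<^sub>R x) $ i) =
        c * (x $ a + (\<Sum>i\<in>B. w i * x $ i))"
      by (simp add: distrib_left sum_distrib_left mult.left_commute)
    ultimately show "c *\<^sub>R x \<in> ?S" by simp
  qed simp
  moreover have "?f i \<in> ?S" if "i \<in> B" for i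
  proof -
    have "(\<Sum>j\<in>B. w j * ?f i $ j) = (\<Sum>j\<in>B. if j = i then w i else 0)"
      using assms by (intro sum.cong) (auto simp: axis_def)
    then show ?thesis using that assms by (auto simp: axis_def)
  qed
  ultimately show "span (?f ` B) \<subseteq> ?S"
    by (intro span_minimal) auto
next
  show "?S \<subseteq> span (?f ` B)"
  proof
    fix v assume v: "v \<in> ?S"
    \<comment> \<open>On \<open>B\<close> the coefficients are the coordinates of \<open>v\<close>;
      at \<open>a\<close> the combination yields minus the weighted sum, which the defining equation
      equates with \<open>v $ a\<close>.\<close>
    have "v $ k = (\<Sum>i\<in>B. v $ i *\<^sub>R ?f i) $ k" for k
    proof -
      have "(\<Sum>i\<in>B. v $ i *\<^sub>R ?f i) $ k
          = (\<Sum>i\<in>B. (if k = i then v $ i else 0) - (if k = a then w i * v $ i else 0))"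
        unfolding sum_component by (intro sum.cong) (use assms in \<open>auto simp: axis_def\<close>)
      also have "\<dots> = (if k \<in> B then v $ k else 0) - (if k = a then \<Sum>i\<in>B. w i * v $ i else 0)"
        by (simp add: sum_subtractf)
      also have "\<dots> = v $ k"
        using v assms by auto
      finally show ?thesis by simp
    qed
    then have "v = (\<Sum>i\<in>B. v $ i *\<^sub>R ?f i)"
      by (intro vec_eq_iff[THEN iffD2] allI)
    moreover have "(\<Sum>i\<in>B. v $ i *\<^sub>R ?f i) \<in> span (?f ` B)"
      by (intro span_sum span_scale span_base imageI)
    ultimately show "v \<in> span (?f ` B)" by metis
  qed
qed

section \<open>Sign vectors and equilibria with two opposite phases\<close>

definition phase_sign :: "'n set \<Rightarrow> 'n \<Rightarrow> real" where
  "phase_sign B i = (if i \<in> B then - 1 else 1)"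

lemma sum_phase_sign_mult:
  fixes f :: "'n::finite \<Rightarrow> real"
  shows "(\<Sum>i\<in>UNIV. phase_sign B i * f i) = sum f (- B) - sum f B"
proof -
  have "(\<Sum>i\<in>UNIV. phase_sign B i * f i)
      = (\<Sum>i\<in>- B. phase_sign B i * f i) + (\<Sum>i\<in>B. phase_sign B i * f i)"
    by (subst sum.union_disjoint[symmetric]) (auto intro!: sum.cong)
  also have "\<dots> = sum f (- B) - sum f B"
    by (simp add: phase_sign_def sum_negf)
  finally show ?thesis .
qed

lemma card_Compl_real:
  "real (card (- B)) = real CARD('n) - real (card (B :: 'n::finite set))"
  by (simp add: Compl_eq_Diff_UNIV card_Diff_subset of_nat_diff card_mono)

lemma sum_phase_sign:
  "(\<Sum>i\<in>UNIV. phase_sign B i) = real CARD('n) - 2 * real (card (B :: 'n::finite set))"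
  using sum_phase_sign_mult[of B "\<lambda>_. 1"] by (simp add: card_Compl_real)

text \<open>\<open>B\<close> is the set of oscillators in antiphase to \<open>q\<close>: empty for
  coherent equilibria, a block of \<open>J\<close> indices for partially coherent ones. One
  computation covers both, and no order on the indices enters. \<open>S\<close> is the sum of the
  signs.\<close>

locale two_phase_equilibrium =
  fixes K :: real and \<theta> :: "real ^ 'n::finite" and B :: "'n set" and q :: real
  assumes K: "K > 0"
    and phase: "\<And>i. [\<theta> $ i = (if i \<in> B then q + pi else q)] (rmod (2 * pi))"
begin

abbreviation "A \<equiv> jacobian (kuramoto K) (at \<theta>)"
abbreviation "S \<equiv> real CARD('n) - 2 * real (card B)"

text \<open>Adding \<open>pi\<close> flips both cosine and sine, so each phase contributes its sign
  times the values at \<open>q\<close>, whose squares sum to 1.\<close>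

lemma cos_diff_phase: "cos (\<theta> $ j - \<theta> $ i) = phase_sign B j * phase_sign B i"
proof -
  have "cos (\<theta> $ i) = phase_sign B i * cos q \<and> sin (\<theta> $ i) = phase_sign B i * sin q" for i
  proof -
    have "cos (\<theta> $ i) = cos (if i \<in> B then q + pi else q)"
         "sin (\<theta> $ i) = sin (if i \<in> B then q + pi else q)"
      by (rule cos_rcong[OF phase], rule sin_rcong[OF phase])
    then show ?thesis by (auto simp: phase_sign_def)
  qed
  then have "cos (\<theta> $ j - \<theta> $ i)
      = phase_sign B j * phase_sign B i * ((cos q)\<^sup>2 + (sin q)\<^sup>2)"
    by (simp only: cos_diff power2_eq_square) (simp only: algebra_simps)
  then show ?thesis by simp
qed

lemma jacobian_nth:
  "(A *v v) $ i = K / real CARD('n) * (phase_sign B i * (sum (($) v) (- B) - sum (($) v) B - S * v $ i))"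
proof -
  have "(\<Sum>j\<in>UNIV. cos (\<theta> $ j - \<theta> $ i) * (v $ j - v $ i)) =
      (\<Sum>j\<in>UNIV. phase_sign B i * (phase_sign B j * v $ j - phase_sign B j * v $ i))"
    unfolding cos_diff_phase by (rule sum.cong[OF refl]) (simp only: right_diff_distrib mult_ac)
  also have "\<dots> = phase_sign B i * ((\<Sum>j\<in>UNIV. phase_sign B j * v $ j)
      - (\<Sum>j\<in>UNIV. phase_sign B j) * v $ i)"
    by (simp only: sum_subtractf flip: sum_distrib_left sum_distrib_right)
  finally show ?thesis
    by (simp only: jacobian_kuramoto vec_lambda_beta sum_phase_sign_mult sum_phase_sign)
qed

text \<open>Writing the eigenvalue as \<open>K * \<mu> / N\<close> lets the nonzero factor
  \<open>K / N\<close> cancel. The difference of block sums is \<open>s \<bullet> v\<close>, the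
  same number in every coordinate equation, called \<open>P\<close> in several proofs below.\<close>

lemma mem_eigenspace_iff:
  "v \<in> eigenspace A (K * \<mu> / real CARD('n)) \<longleftrightarrow>
    (\<forall>i. phase_sign B i * (sum (($) v) (- B) - sum (($) v) B - S * v $ i) = \<mu> * v $ i)"
proof -
  have "(K / real CARD('n) * x = K * \<mu> / real CARD('n) * y) \<longleftrightarrow> (x = \<mu> * y)" for x y
  proof -
    have "K * \<mu> / real CARD('n) * y = K / real CARD('n) * (\<mu> * y)" by simp
    moreover have "K / real CARD('n) \<noteq> 0" using K by simp
    ultimately show ?thesis by (metis mult_cancel_left)
  qed
  then show ?thesis
    unfolding eigenspace_def vec_eq_iff mem_Collect_eq jacobian_nth by simp
qed

text \<open>For \<open>\<mu> = 0\<close> the sign cancels and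
  \<open>S * v $ i = s \<bullet> v\<close> remains, so all coordinates agree once \<open>S\<close>
  is nonzero.\<close>

lemma eigenspace_0:
  assumes "S \<noteq> 0"
  shows "eigenspace A 0 = span {vec 1}"
proof (intro set_eqI)
  fix v :: "real ^ 'n"
  have "v \<in> eigenspace A 0 \<longleftrightarrow> (\<forall>i. sum (($) v) (- B) - sum (($) v) B = S * v $ i)"
    using mem_eigenspace_iff[of v 0] by (auto simp: phase_sign_def)
  also have "\<dots> \<longleftrightarrow> (\<exists>c. v = c *\<^sub>R vec 1)"
  proof
    assume "\<forall>i. sum (($) v) (- B) - sum (($) v) B = S * v $ i"
    then have "v $ i = (sum (($) v) (- B) - sum (($) v) B) / S" for i
      using assms nonzero_mult_div_cancel_left by metis
    then have "v = ((sum (($) v) (- B) - sum (($) v) B) / S) *\<^sub>R vec 1"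
      by (intro vec_eq_iff[THEN iffD2] allI)
        (simp only: vector_scaleR_component vec_component real_scaleR_def mult_1_right)
    then show "\<exists>c. v = c *\<^sub>R vec 1" ..
  next
    assume "\<exists>c. v = c *\<^sub>R vec 1"
    then show "\<forall>i. sum (($) v) (- B) - sum (($) v) B = S * v $ i"
      by (auto simp: card_Compl_real algebra_simps)
  qed
  finally show "v \<in> eigenspace A 0 \<longleftrightarrow> v \<in> span {vec 1}"
    by (auto simp: span_singleton)
qed

text \<open>With both phases equally populated the diagonal term disappears, and all coordinate
  equations collapse to \<open>s \<bullet> v = 0\<close>.\<close>

lemma eigenspace_0_balanced:
  assumes "S = 0"
  shows "eigenspace A 0 = {v. sum (($) v) (- B) - sum (($) v) B = 0}"
proof (intro set_eqI)
  fix v :: "real ^ 'n"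
  have "phase_sign B i \<noteq> 0" for i by (simp add: phase_sign_def)
  then show "v \<in> eigenspace A 0 \<longleftrightarrow> v \<in> {v. sum (($) v) (- B) - sum (($) v) B = 0}"
    using mem_eigenspace_iff[of v 0]
    by (simp only: assms mult_zero_left mult_zero_right div_0 diff_0_right mult_eq_0_iff simp_thms
        mem_Collect_eq)
qed

text \<open>Here \<open>\<mu> = N\<close>. With \<open>J = card B\<close> the solution is
  \<open>P / (2 * (N - J))\<close> off \<open>B\<close> and \<open>- P / (2 * J)\<close> on
  \<open>B\<close>, a multiple of the stated vector. The assumptions make \<open>J\<close> and
  \<open>N - J\<close> positive.\<close>

lemma eigenspace_K:
  assumes "B \<noteq> {}" "S \<ge> 0"
  shows "eigenspace A K = span {vec 1 - (real CARD('n) / real (card B)) *\<^sub>R (\<Sum>i\<in>B. axis i 1)}"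
proof (intro set_eqI)
  fix v :: "real ^ 'n"
  define J where "J = real (card B)"
  define u where "u = vec 1 - (real CARD('n) / J) *\<^sub>R (\<Sum>i\<in>B. axis i (1::real))"
  have J: "J > 0" using assms by (simp add: J_def card_gt_0_iff)
  have NJ: "real CARD('n) - J > 0" using J assms by (simp add: J_def)
  have u: "u $ i = (if i \<in> B then 1 - real CARD('n) / J else 1)" for i
    by (simp add: u_def axis_def)
  define P where "P = sum (($) v) (- B) - sum (($) v) B"
  have "v \<in> eigenspace A K \<longleftrightarrow> (\<forall>i. phase_sign B i * (P - S * v $ i) = real CARD('n) * v $ i)"
    using mem_eigenspace_iff[of v "real CARD('n)"] by (simp add: P_def)
  also have "\<dots> \<longleftrightarrow> (\<forall>i. 2 * (real CARD('n) - J) * v $ i = P * u $ i)"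
  proof (intro all_cong1)
    fix i
    show "phase_sign B i * (P - S * v $ i) = real CARD('n) * v $ i \<longleftrightarrow> 2 * (real CARD('n) - J) * v $ i = P * u $ i"
    proof (cases "i \<in> B")
      case True
      \<comment> \<open>On \<open>B\<close> the entry of \<open>u\<close> is
        \<open>- (N - J) / J\<close>, so the positive factor \<open>N - J\<close> cancels.\<close>
      have "2 * (real CARD('n) - J) * v $ i = P * u $ i \<longleftrightarrow> (real CARD('n) - J) * (2 * J * v $ i) = (real CARD('n) - J) * (- P)"
        using J by (simp add: u True field_simps)
      also have "\<dots> \<longleftrightarrow> 2 * J * v $ i = - P"
        using NJ by (metis less_irrefl mult_cancel_left)
      finally show ?thesis
        by (auto simp: phase_sign_def True J_def algebra_simps)
    qed (auto simp: phase_sign_def u J_def algebra_simps)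
  qed
  also have "\<dots> \<longleftrightarrow> (\<exists>c. v = c *\<^sub>R u)"
  proof
    assume *: "\<forall>i. 2 * (real CARD('n) - J) * v $ i = P * u $ i"
    then have "v = (P / (2 * (real CARD('n) - J))) *\<^sub>R u"
      using NJ by (simp add: vec_eq_iff field_simps)
    then show "\<exists>c. v = c *\<^sub>R u" ..
  next
    assume "\<exists>c. v = c *\<^sub>R u"
    then obtain c where c: "v = c *\<^sub>R u" ..
    \<comment> \<open>Consistency: the signs paired with \<open>u\<close> give
      \<open>(N - J) - (J - N)\<close>.\<close>
    have "P = c * (2 * (real CARD('n) - J))"
      using J by (simp add: P_def c u card_Compl_real field_simps flip: J_def)
    then show "\<forall>i. 2 * (real CARD('n) - J) * v $ i = P * u $ i" by (simp add: c)
  qed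
  finally show "v \<in> eigenspace A K \<longleftrightarrow>
      v \<in> span {vec 1 - (real CARD('n) / real (card B)) *\<^sub>R (\<Sum>i\<in>B. axis i 1)}"
    by (auto simp: span_singleton u_def J_def)
qed

text \<open>With \<open>\<mu> = S\<close> the terms in \<open>v $ i\<close> cancel on
  \<open>B\<close>, leaving \<open>P = 0\<close>; off \<open>B\<close> they double and force
  \<open>v $ i = 0\<close>. The condition \<open>P = 0\<close> then involves only
  \<open>B\<close>.\<close>

lemma eigenspace_flipped:
  assumes "B \<noteq> {}" "S \<noteq> 0"
  shows "eigenspace A (K * (S / real CARD('n))) = {v. (\<forall>i. i \<notin> B \<longrightarrow> v $ i = 0) \<and> sum (($) v) B = 0}"
proof (intro set_eqI)
  fix v :: "real ^ 'n"
  define P where "P = sum (($) v) (- B) - sum (($) v) B"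
  have "v \<in> eigenspace A (K * (S / real CARD('n))) \<longleftrightarrow> (\<forall>i. phase_sign B i * (P - S * v $ i) = S * v $ i)"
    using mem_eigenspace_iff[of v S] by (simp add: P_def)
  also have "\<dots> \<longleftrightarrow> P = 0 \<and> (\<forall>i. i \<notin> B \<longrightarrow> v $ i = 0)"
  proof
    assume *: "\<forall>i. phase_sign B i * (P - S * v $ i) = S * v $ i"
    obtain b where "b \<in> B" using assms by blast
    with *[rule_format, of b] have "P = 0" by (simp only: phase_sign_def if_True if_False) (simp add: algebra_simps)
    moreover have "v $ i = 0" if "i \<notin> B" for i
      using *[rule_format, of i] \<open>P = 0\<close> that assms(2)
      by (simp only: phase_sign_def if_True if_False) (simp add: algebra_simps)
    ultimately show "P = 0 \<and> (\<forall>i. i \<notin> B \<longrightarrow> v $ i = 0)" by blast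
  qed (auto simp: phase_sign_def)
  also have "\<dots> \<longleftrightarrow> (\<forall>i. i \<notin> B \<longrightarrow> v $ i = 0) \<and> sum (($) v) B = 0"
    by (auto simp: P_def)
  finally show "v \<in> eigenspace A (K * (S / real CARD('n))) \<longleftrightarrow>
      v \<in> {v. (\<forall>i. i \<notin> B \<longrightarrow> v $ i = 0) \<and> sum (($) v) B = 0}" by simp
qed

text \<open>The mirror image with \<open>\<mu> = - S\<close>: an index off \<open>B\<close> yields
  \<open>P = 0\<close>, and the coordinates on \<open>B\<close> vanish.\<close>

lemma eigenspace_unflipped:
  assumes "B \<noteq> UNIV" "S \<noteq> 0"
  shows "eigenspace A (K * (- S / real CARD('n))) = {v. (\<forall>i\<in>B. v $ i = 0) \<and> sum (($) v) (- B) = 0}"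
proof (intro set_eqI)
  fix v :: "real ^ 'n"
  define P where "P = sum (($) v) (- B) - sum (($) v) B"
  have "v \<in> eigenspace A (K * (- S / real CARD('n))) \<longleftrightarrow>
      (\<forall>i. phase_sign B i * (P - S * v $ i) = - S * v $ i)"
    using mem_eigenspace_iff[of v "- S"] by (simp add: P_def)
  also have "\<dots> \<longleftrightarrow> P = 0 \<and> (\<forall>i\<in>B. v $ i = 0)"
  proof
    assume *: "\<forall>i. phase_sign B i * (P - S * v $ i) = - S * v $ i"
    obtain b where "b \<notin> B" using assms by blast
    with *[rule_format, of b] have "P = 0" by (simp only: phase_sign_def if_True if_False) (simp add: algebra_simps)
    moreover have "v $ i = 0" if "i \<in> B" for i
      using *[rule_format, of i] \<open>P = 0\<close> that assms(2)
      by (simp only: phase_sign_def if_True if_False) (simp add: algebra_simps)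
    ultimately show "P = 0 \<and> (\<forall>i\<in>B. v $ i = 0)" by blast
  qed (auto simp: phase_sign_def algebra_simps)
  also have "\<dots> \<longleftrightarrow> (\<forall>i\<in>B. v $ i = 0) \<and> sum (($) v) (- B) = 0"
    by (auto simp: P_def)
  finally show "v \<in> eigenspace A (K * (- S / real CARD('n))) \<longleftrightarrow>
      v \<in> {v. (\<forall>i\<in>B. v $ i = 0) \<and> sum (($) v) (- B) = 0}" by simp
qed

end

section \<open>Rank-two matrices and incoherent equilibria\<close>

lemma eigenspace_orthogonal_rank_two:
  fixes c d :: "real ^ 'n::finite"
  assumes A: "\<And>v. A *v v = k *\<^sub>R ((c \<bullet> v) *\<^sub>R c + (d \<bullet> v) *\<^sub>R d)"
    and k: "k > 0" and cd: "c \<bullet> d = 0" and c: "c \<noteq> 0" and d: "d \<noteq> 0"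
  shows eigenspace_orthogonal_rank_two_0: "dim (eigenspace A 0) + 2 = CARD('n)"
    and eigenspace_orthogonal_rank_two_1:
      "c \<bullet> c \<noteq> d \<bullet> d \<Longrightarrow> dim (eigenspace A (k * (c \<bullet> c))) = 1"
    and eigenspace_orthogonal_rank_two_2:
      "c \<bullet> c = d \<bullet> d \<Longrightarrow> dim (eigenspace A (k * (c \<bullet> c))) = 2"
proof -
  \<comment> \<open>By orthogonality \<open>c\<close> and \<open>d\<close> are eigenvectors for
    \<open>k * (c \<bullet> c)\<close> and \<open>k * (d \<bullet> d)\<close>, and the kernel is
    their orthogonal complement.\<close>
  have dc: "d \<bullet> c = 0" using cd by (simp add: inner_commute)
  have "c \<noteq> d" using cd c by auto
  have "independent {c, d}"
    by (rule pairwise_orthogonal_independent)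
      (use c d cd dc in \<open>auto simp: pairwise_def orthogonal_def\<close>)
  then have dim2: "dim (span {c, d}) = 2"
    using \<open>c \<noteq> d\<close> by (simp add: dim_eq_card_independent)
  have comb: "a *\<^sub>R c + b *\<^sub>R d = 0 \<longleftrightarrow> a = 0 \<and> b = 0" for a b
  proof
    assume *: "a *\<^sub>R c + b *\<^sub>R d = 0"
    have "c \<bullet> (a *\<^sub>R c + b *\<^sub>R d) = a * (c \<bullet> c)" "d \<bullet> (a *\<^sub>R c + b *\<^sub>R d) = b * (d \<bullet> d)"
      by (simp_all add: inner_add_right cd dc)
    with * c d show "a = 0 \<and> b = 0" by simp
  qed simp
  have "eigenspace A 0 = {v \<in> UNIV. \<forall>x\<in>span {c, d}. orthogonal x v}"
  proof (intro set_eqI)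
    fix v :: "real ^ 'n"
    have "v \<in> eigenspace A 0 \<longleftrightarrow> c \<bullet> v = 0 \<and> d \<bullet> v = 0"
      using k by (simp add: eigenspace_def A comb)
    also have "\<dots> \<longleftrightarrow> (\<forall>x\<in>span {c, d}. orthogonal x v)"
      using span_base[of _ "{c, d}"]
      by (auto simp: orthogonal_def span_insert span_singleton inner_add_left inner_diff_left
          algebra_simps)
    finally show "v \<in> eigenspace A 0 \<longleftrightarrow> v \<in> {v \<in> UNIV. \<forall>x\<in>span {c, d}. orthogonal x v}"
      by simp
  qed
  then show "dim (eigenspace A 0) + 2 = CARD('n)"
    using dim_subspace_orthogonal_to_vectors[of "span {c, d}" UNIV] dim2 by simp
  have mem: "v \<in> eigenspace A (k * (c \<bullet> c)) \<longleftrightarrow>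
      (c \<bullet> v) *\<^sub>R c + (d \<bullet> v) *\<^sub>R d = (c \<bullet> c) *\<^sub>R v" for v
    using k by (simp add: eigenspace_def A flip: scaleR_scaleR)
  \<comment> \<open>The eigenvalue is nonzero, so an eigenvector lies in the image of
    \<open>A\<close>, hence in the span of \<open>c\<close> and \<open>d\<close>.\<close>
  have repr: "v = (c \<bullet> v / (c \<bullet> c)) *\<^sub>R c + (d \<bullet> v / (c \<bullet> c)) *\<^sub>R d"
    if "v \<in> eigenspace A (k * (c \<bullet> c))" for v
  proof -
    have "v = (1 / (c \<bullet> c)) *\<^sub>R ((c \<bullet> c) *\<^sub>R v)" using c by simp
    also have "(c \<bullet> c) *\<^sub>R v = (c \<bullet> v) *\<^sub>R c + (d \<bullet> v) *\<^sub>R d" using that mem by simp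
    finally show ?thesis by (simp add: scaleR_add_right)
  qed
  show "dim (eigenspace A (k * (c \<bullet> c))) = 1" if ne: "c \<bullet> c \<noteq> d \<bullet> d"
  proof -
    have "eigenspace A (k * (c \<bullet> c)) = span {c}"
    proof (intro set_eqI iffI)
      fix v assume v: "v \<in> eigenspace A (k * (c \<bullet> c))"
      \<comment> \<open>Pairing with \<open>d\<close> gives \<open>(d \<bullet> d) * (d \<bullet> v)
        = (c \<bullet> c) * (d \<bullet> v)\<close>, so distinct norms remove the component along
        \<open>d\<close>.\<close>
      have "d \<bullet> ((c \<bullet> v) *\<^sub>R c + (d \<bullet> v) *\<^sub>R d) = d \<bullet> ((c \<bullet> c) *\<^sub>R v)"
        using v mem by simp
      then have "d \<bullet> v = 0" using ne by (simp add: inner_add_right dc)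
      with repr[OF v] show "v \<in> span {c}" by (auto simp: span_singleton)
    next
      fix v assume "v \<in> span {c}"
      then show "v \<in> eigenspace A (k * (c \<bullet> c))" by (auto simp: span_singleton mem dc)
    qed
    then show ?thesis using c by (simp add: dim_eq_card_independent)
  qed
  show "dim (eigenspace A (k * (c \<bullet> c))) = 2" if eq: "c \<bullet> c = d \<bullet> d"
  proof -
    \<comment> \<open>With equal norms \<open>A\<close> acts on the whole plane as a multiple of the
      identity.\<close>
    have "eigenspace A (k * (c \<bullet> c)) = span {c, d}"
    proof (intro set_eqI iffI)
      fix v assume "v \<in> eigenspace A (k * (c \<bullet> c))"
      from repr[OF this] show "v \<in> span {c, d}"
        by (metis span_add span_scale span_base insertI1 insertI2)
    next
      fix v assume "v \<in> span {c, d}"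
      then obtain a b where v: "v = a *\<^sub>R c + b *\<^sub>R d"
        by (auto simp: span_insert span_singleton algebra_simps)
      show "v \<in> eigenspace A (k * (c \<bullet> c))"
        unfolding mem by (simp add: v inner_add_right cd dc eq scaleR_add_right mult_ac)
    qed
    then show ?thesis using dim2 by simp
  qed
qed

lemma eigenvalue_if_dim_pos:
  assumes "dim (eigenspace A c) > 0"
  shows "eigenvalue A c"
proof (rule ccontr)
  assume "\<not> eigenvalue A c"
  then have "eigenspace A c \<subseteq> {0}" by (auto simp: eigenvalue_def eigenspace_def)
  with assms show False by (metis dim_eq_0 less_irrefl)
qed

text \<open>The sums of cosines and of sines vanish, so the term multiplying \<open>v $ i\<close>
  drops out, and the addition formula splits the rest into two rank-one terms. The angle
  \<open>\<phi>\<close> stays free so that it can later be chosen to make the two vectors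
  orthogonal.\<close>

lemma incoherent_jacobian:
  fixes \<theta> :: "real ^ 'n::finite"
  assumes "incoherent \<theta>"
  shows "jacobian (kuramoto K) (at \<theta>) *v v = (K / real CARD('n)) *\<^sub>R
    (((\<chi> i. cos (\<theta> $ i - \<phi>)) \<bullet> v) *\<^sub>R (\<chi> i. cos (\<theta> $ i - \<phi>)) +
     ((\<chi> i. sin (\<theta> $ i - \<phi>)) \<bullet> v) *\<^sub>R (\<chi> i. sin (\<theta> $ i - \<phi>)))"
proof -
  have z: "(\<Sum>j\<in>UNIV. cis (\<theta> $ j)) = 0"
    using assms by (simp add: incoherent_def cis_conv_exp)
  have c: "(\<Sum>j\<in>UNIV. cos (\<theta> $ j)) = 0" and s: "(\<Sum>j\<in>UNIV. sin (\<theta> $ j)) = 0"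
    using arg_cong[OF z, of Re] arg_cong[OF z, of Im] by simp_all
  have "(\<Sum>j\<in>UNIV. cos (\<theta> $ j - \<theta> $ i)) = 0" for i
    by (simp add: cos_diff sum.distrib c s flip: sum_distrib_right)
  moreover have "cos (\<theta> $ j - \<theta> $ i) = cos (\<theta> $ j - \<phi>) * cos (\<theta> $ i - \<phi>)
      + sin (\<theta> $ j - \<phi>) * sin (\<theta> $ i - \<phi>)" for i j
    using cos_diff[of "\<theta> $ j - \<phi>" "\<theta> $ i - \<phi>"] by simp
  ultimately have "(\<Sum>j\<in>UNIV. cos (\<theta> $ j - \<theta> $ i) * (v $ j - v $ i)) =
      (\<Sum>j\<in>UNIV. (cos (\<theta> $ j - \<phi>) * cos (\<theta> $ i - \<phi>)
        + sin (\<theta> $ j - \<phi>) * sin (\<theta> $ i - \<phi>)) * v $ j)" for i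
    by (simp add: right_diff_distrib sum_subtractf flip: sum_distrib_right)
  then show ?thesis
    by (simp add: jacobian_kuramoto vec_eq_iff inner_vec_def distrib_left distrib_right
        sum.distrib sum_distrib_left sum_distrib_right mult_ac)
qed

text \<open>\<open>l2\<close> and \<open>l3\<close> coincide exactly when \<open>r = 0\<close>, for
  example at three equally spaced phases. Their common value \<open>K / 2\<close> then has a
  two-dimensional eigenspace, so one-dimensionality is asserted only for
  \<open>l2 \<noteq> l3\<close>.\<close>

lemma incoherent_spectrum:
  fixes \<theta> :: "real ^ 'n::finite"
  assumes K: "K > 0" and inc: "incoherent \<theta>"
    and ne: "\<forall>k::int. \<theta> $ i0 - \<theta> $ i1 \<noteq> of_int k * pi"
  defines "A \<equiv> jacobian (kuramoto K) (at \<theta>)"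
    and "r \<equiv> cmod (\<Sum>j\<in>UNIV. exp (2 * \<i> * complex_of_real (\<theta> $ j)))"
  defines "l2 \<equiv> K / 2 * (1 + 1 / real CARD('n) * r)" and "l3 \<equiv> K / 2 * (1 - 1 / real CARD('n) * r)"
  shows "eigenvalue A 0 \<and> dim (eigenspace A 0) + 2 = CARD('n) \<and> eigenvalue A l2 \<and> eigenvalue A l3 \<and>
    (l2 \<noteq> l3 \<longrightarrow> dim (eigenspace A l2) = 1 \<and> dim (eigenspace A l3) = 1) \<and>
    (l2 = l3 \<longrightarrow> dim (eigenspace A l2) = 2)"
proof -
  define R where "R = (\<Sum>j\<in>UNIV. cis (2 * \<theta> $ j))"
  have r: "r = cmod R" by (simp add: r_def R_def cis_conv_exp mult_ac)
  \<comment> \<open>Halving the argument makes the sum over the shifted and doubled phases real and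
    nonnegative.\<close>
  define \<phi> where "\<phi> = Arg R / 2"
  define c where "c = (\<chi> i. cos (\<theta> $ i - \<phi>))"
  define d where "d = (\<chi> i. sin (\<theta> $ i - \<phi>))"
  have "(\<Sum>j\<in>UNIV. cis (2 * (\<theta> $ j - \<phi>))) = R * cis (- Arg R)"
    by (simp add: R_def sum_distrib_right cis_mult \<phi>_def algebra_simps)
  also have "\<dots> = complex_of_real r"
  proof -
    have "R = complex_of_real r * cis (Arg R)"
      by (metis r rcis_def rcis_cmod_Arg)
    then have "R * cis (- Arg R) = complex_of_real r * (cis (Arg R) * cis (- Arg R))"
      by (metis mult.assoc)
    then show ?thesis by (simp add: cis_mult)
  qed
  finally have sum2: "(\<Sum>j\<in>UNIV. cis (2 * (\<theta> $ j - \<phi>))) = complex_of_real r" .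
  \<comment> \<open>Double-angle formulas turn the real part of \<open>sum2\<close> into the
    difference of the squared norms and its imaginary part, below, into
    \<open>2 * (c \<bullet> d)\<close>.\<close>
  have diff: "c \<bullet> c - d \<bullet> d = r"
    using arg_cong[OF sum2, of Re]
    by (simp only: Re_sum cis.sel cos_double c_def d_def inner_vec_def)
      (simp add: sum_subtractf power2_eq_square)
  have "2 * (c \<bullet> d) = 0"
    using arg_cong[OF sum2, of Im]
    by (simp only: Im_sum cis.sel sin_double c_def d_def inner_vec_def)
      (simp add: sum_distrib_left mult_ac)
  then have cd: "c \<bullet> d = 0" by simp
  have "c \<bullet> c + d \<bullet> d = real CARD('n)"
    by (simp add: c_def d_def inner_vec_def flip: sum.distrib power2_eq_square)
  with diff have cc: "c \<bullet> c = (real CARD('n) + r) / 2" and dd: "d \<bullet> d = (real CARD('n) - r) / 2"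
    by simp_all
  have "r \<ge> 0" by (simp add: r)
  then have "c \<bullet> c > 0" by (simp add: cc add_pos_nonneg)
  then have c0: "c \<noteq> 0" by auto
  \<comment> \<open>If \<open>d\<close> vanished, all phases would differ by multiples of
    \<open>pi\<close>, against the assumption on \<open>i0\<close> and \<open>i1\<close>.\<close>
  have d0: "d \<noteq> 0"
  proof
    assume "d = 0"
    then have "sin (\<theta> $ i - \<phi>) = 0" for i by (simp add: d_def vec_eq_iff)
    then have "\<exists>m::int. \<theta> $ i - \<phi> = of_int m * pi" for i
      by (metis sin_zero_iff_int2)
    then obtain m n :: int where "\<theta> $ i0 - \<phi> = of_int m * pi" "\<theta> $ i1 - \<phi> = of_int n * pi"
      by blast
    then have "\<theta> $ i0 - \<theta> $ i1 = of_int (m - n) * pi" by (simp add: algebra_simps)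
    with ne show False by blast
  qed
  define k where "k = K / real CARD('n)"
  have k: "k > 0" using K by (simp add: k_def)
  have A: "A *v v = k *\<^sub>R ((c \<bullet> v) *\<^sub>R c + (d \<bullet> v) *\<^sub>R d)" for v
    unfolding A_def c_def d_def k_def by (rule incoherent_jacobian[OF inc])
  have A': "A *v v = k *\<^sub>R ((d \<bullet> v) *\<^sub>R d + (c \<bullet> v) *\<^sub>R c)" for v
    by (simp add: A add.commute)
  have dc: "d \<bullet> c = 0" using cd by (simp add: inner_commute)
  have l2: "l2 = k * (c \<bullet> c)" and l3: "l3 = k * (d \<bullet> d)"
    by (simp_all add: l2_def l3_def k_def cc dd field_simps)
  \<comment> \<open>The nonzero eigenvalue of the rank-two result belongs to its first vector;
    exchanging \<open>c\<close> and \<open>d\<close> covers \<open>l3\<close>.\<close>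
  note c_facts = A k cd c0 d0
  note d_facts = A' k dc d0 c0
  have eq: "l2 = l3 \<longleftrightarrow> c \<bullet> c = d \<bullet> d" using k by (simp add: l2 l3)
  have simple: "dim (eigenspace A l2) = 1 \<and> dim (eigenspace A l3) = 1" if "l2 \<noteq> l3"
    using eigenspace_orthogonal_rank_two_1[OF c_facts] eigenspace_orthogonal_rank_two_1[OF d_facts]
      that eq unfolding l2 l3 by metis
  have double: "dim (eigenspace A l2) = 2" if "l2 = l3"
    using eigenspace_orthogonal_rank_two_2[OF c_facts] that eq unfolding l2 by metis
  \<comment> \<open>The dimension formula alone would allow a trivial kernel; the constant vector
    excludes it.\<close>
  have "eigenvalue A 0"
    unfolding eigenvalue_def
    by (rule exI[of _ "vec 1"]) (simp add: A_def jacobian_kuramoto vec_eq_iff)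
  moreover have "dim (eigenspace A 0) + 2 = CARD('n)"
    by (rule eigenspace_orthogonal_rank_two_0[OF c_facts])
  moreover have "eigenvalue A l2" "eigenvalue A l3"
    using simple double by (cases "l2 = l3"; simp add: eigenvalue_if_dim_pos)+
  ultimately show ?thesis using simple double by blast
qed

section \<open>Spectra in terms of the enumeration of the oscillators\<close>

lemma vec_1_mem_eigenspace_0: "vec 1 \<in> eigenspace (jacobian (kuramoto K) (at \<theta>)) 0"
  by (simp add: eigenspace_def jacobian_kuramoto vec_eq_iff)

text \<open>Unit weights with the first label as pivot. For \<open>m = n\<close> the family is empty
  and both sides are the zero space.\<close>

lemma span_axis_differences_interval:
  fixes lab :: "nat \<Rightarrow> 'n::finite"
  assumes inj: "inj_on lab {m..n}" and "m \<le> n"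
  shows "span ((\<lambda>j. axis (lab j) 1 - axis (lab m) 1) ` {Suc m..n}) =
    {v :: real ^ 'n. (\<forall>i. i \<notin> lab ` {m..n} \<longrightarrow> v $ i = 0) \<and> sum (($) v) (lab ` {m..n}) = 0}"
proof -
  have split: "lab ` {m..n} = insert (lab m) (lab ` {Suc m..n})"
    using \<open>m \<le> n\<close> by (simp add: atLeastAtMost_insertL flip: image_insert)
  have notin: "lab m \<notin> lab ` {Suc m..n}"
    using inj \<open>m \<le> n\<close> by (auto dest: inj_onD)
  show ?thesis
    using span_axis_differences[OF notin, of "\<lambda>_. 1"] notin
    by (simp add: split image_image)
qed

lemma axis_difference_nonzero:
  assumes "inj_on lab T" "j \<in> T" "k \<in> T" "j \<noteq> k"
  shows "axis (lab j) (1::real) - axis (lab k) 1 \<noteq> 0"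
  using assms by (auto simp: axis_eq_axis dest: inj_onD)

text \<open>Passes from labels to sets: injectivity of \<open>lab\<close> makes the first
  \<open>J\<close> labels a block of exactly \<open>J\<close> indices, and the remaining labels its
  complement.\<close>

lemma partially_coherentE:
  fixes lab :: "nat \<Rightarrow> 'n::finite"
  assumes K: "K > 0" and lab: "bij_betw lab {1..CARD('n)} UNIV" and pc: "partially_coherent lab J \<theta>"
  obtains q where "two_phase_equilibrium K \<theta> (lab ` {1..J}) q"
    "card (lab ` {1..J}) = J" "- (lab ` {1..J}) = lab ` {J + 1..CARD('n)}" "1 \<le> J" "2 * J \<le> CARD('n)"
proof -
  have J: "1 \<le> J" "2 * J \<le> CARD('n)" using pc by (auto simp: partially_coherent_def)
  have inj: "inj_on lab {1..CARD('n)}" and surj: "lab ` {1..CARD('n)} = UNIV"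
    using lab by (auto simp: bij_betw_def)
  have mem: "lab j \<in> lab ` {1..J} \<longleftrightarrow> j \<le> J" if "j \<in> {1..CARD('n)}" for j
    using that J inj_on_image_mem_iff[OF inj that, of "{1..J}"] by auto
  obtain q where q: "\<forall>j\<in>{1..CARD('n)}. [\<theta> $ lab j = (if j \<le> J then q + pi else q)] (rmod (2 * pi))"
    using pc by (auto simp: partially_coherent_def)
  have "two_phase_equilibrium K \<theta> (lab ` {1..J}) q"
  proof
    fix i
    obtain j where "j \<in> {1..CARD('n)}" "i = lab j" using surj by (metis UNIV_I imageE)
    then show "[\<theta> $ i = (if i \<in> lab ` {1..J} then q + pi else q)] (rmod (2 * pi))"
      using q mem by auto
  qed (fact K)
  moreover have "card (lab ` {1..J}) = J"
    using card_image[OF inj_on_subset[OF inj, of "{1..J}"]] J by simp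
  moreover have "- (lab ` {1..J}) = lab ` {J + 1..CARD('n)}"
  proof -
    have "- (lab ` {1..J}) = lab ` {1..CARD('n)} - lab ` {1..J}" using surj by auto
    also have "\<dots> = lab ` ({1..CARD('n)} - {1..J})"
      using inj_on_image_set_diff[OF inj, of "{1..CARD('n)}" "{1..J}"] J by auto
    also have "{1..CARD('n)} - {1..J} = {J + 1..CARD('n)}" by auto
    finally show ?thesis .
  qed
  ultimately show thesis using that J by blast
qed

text \<open>The two-phase computation with \<open>B\<close> empty: \<open>S = N\<close>, so
  \<open>K * (- S / N)\<close> is \<open>- K\<close>. For a single oscillator the family is empty
  and \<open>- K\<close> is not an eigenvalue.\<close>

lemma coherent_spectrum:
  fixes lab :: "nat \<Rightarrow> 'n::finite" and \<theta> :: "real ^ 'n"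
  assumes K: "K > 0" and lab: "bij_betw lab {1..CARD('n)} UNIV" and coh: "coherent \<theta>"
  defines "A \<equiv> jacobian (kuramoto K) (at \<theta>)"
  shows "eigenvalue_with_eigenspace A 0 (span {vec 1})"
    and "CARD('n) \<ge> 2 \<Longrightarrow> eigenvalue_with_eigenspace A (- K)
      (span ((\<lambda>j. axis (lab j) 1 - axis (lab 1) 1) ` {2..CARD('n)}))"
proof -
  obtain q where "\<forall>i. [\<theta> $ i = q] (rmod (2 * pi))"
    using coh unfolding coherent_def by blast
  then interpret two_phase_equilibrium K \<theta> "{}" q
    by unfold_locales (simp_all add: K)
  have inj: "inj_on lab {1..CARD('n)}" and surj: "lab ` {1..CARD('n)} = UNIV"
    using lab by (auto simp: bij_betw_def)
  have "eigenspace A 0 = span {vec 1}"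
    unfolding A_def by (rule eigenspace_0) simp
  then show "eigenvalue_with_eigenspace A 0 (span {vec 1})"
    by (rule eigenvalue_with_eigenspaceI[of _ _ _ "vec 1"]) (auto simp: span_base vec_eq_iff)
  assume N: "CARD('n) \<ge> 2"
  have "eigenspace A (- K) = span ((\<lambda>j. axis (lab j) 1 - axis (lab 1) 1) ` {2..CARD('n)})"
    using eigenspace_unflipped span_axis_differences_interval[OF inj] N
    by (simp add: A_def surj del: One_nat_def)
  then show "eigenvalue_with_eigenspace A (- K)
      (span ((\<lambda>j. axis (lab j) 1 - axis (lab 1) 1) ` {2..CARD('n)}))"
  proof (rule eigenvalue_with_eigenspaceI[OF _ span_base])
    show "axis (lab 2) 1 - axis (lab 1) 1 \<in> (\<lambda>j. axis (lab j) (1::real) - axis (lab 1) 1) ` {2..CARD('n)}"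
      using N by auto
    show "axis (lab 2) (1::real) - axis (lab 1) 1 \<noteq> 0"
      by (rule axis_difference_nonzero[OF inj]) (use N in auto)
  qed
qed

text \<open>Here \<open>S = N - 2 * J\<close>, so \<open>2 * J < N\<close> is the nondegenerate case
  and \<open>2 * J = N\<close> the balanced one. The bounds \<open>2 \<le> J\<close> and
  \<open>J + 2 \<le> N\<close> make the families of differences nonempty and so supply nonzero
  eigenvectors.\<close>

lemma partially_coherent_spectrum:
  fixes lab :: "nat \<Rightarrow> 'n::finite" and \<theta> :: "real ^ 'n"
  assumes K: "K > 0" and lab: "bij_betw lab {1..CARD('n)} UNIV" and pc: "partially_coherent lab J \<theta>"
  defines "A \<equiv> jacobian (kuramoto K) (at \<theta>)" and "e \<equiv> \<lambda>j. axis (lab j) (1::real)"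
    and "N \<equiv> CARD('n)"
  shows partially_coherent_0: "2 * J < N \<Longrightarrow> eigenvalue_with_eigenspace A 0 (span {vec 1})"
    and partially_coherent_K: "eigenvalue_with_eigenspace A K
      (span {vec 1 - (real N / real J) *\<^sub>R (\<Sum>j=1..J. e j)})"
    and partially_coherent_flipped: "2 \<le> J \<Longrightarrow> 2 * J < N \<Longrightarrow>
      eigenvalue_with_eigenspace A (K * ((real N - 2 * real J) / real N))
        (span ((\<lambda>j. e j - e 1) ` {2..J}))"
    and partially_coherent_unflipped: "2 * J < N \<Longrightarrow> J + 2 \<le> N \<Longrightarrow>
      eigenvalue_with_eigenspace A (K * ((2 * real J - real N) / real N))
        (span ((\<lambda>j. e j - e (J + 1)) ` {J + 2..N}))"
    and partially_coherent_balanced_0: "2 * J = N \<Longrightarrow> eigenvalue_with_eigenspace A 0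
      (span ((\<lambda>j. e j - e 1) ` {2..J} \<union> (\<lambda>j. e j + e 1) ` {J + 1..N}))"
    and partially_coherent_balanced_K: "2 * J = N \<Longrightarrow> eigenvalue_with_eigenspace A K
      (span {- (\<Sum>j=1..J. e j) + (\<Sum>j=J + 1..N. e j)})"
proof -
  obtain q where tp: "two_phase_equilibrium K \<theta> (lab ` {1..J}) q"
    and card: "card (lab ` {1..J}) = J" and compl: "- (lab ` {1..J}) = lab ` {J + 1..N}"
    and J: "1 \<le> J" "2 * J \<le> N"
    using partially_coherentE[OF K lab pc] unfolding N_def by blast
  interpret two_phase_equilibrium K \<theta> "lab ` {1..J}" q by (fact tp)
  have inj: "inj_on lab {1..N}" using lab by (simp add: bij_betw_def N_def)
  have injJ: "inj_on lab {1..J}" and injJ': "inj_on lab {J + 1..N}"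
    using J by (auto intro: inj_on_subset[OF inj])
  have vec1: "vec 1 \<noteq> (0 :: real ^ 'n)" by (simp add: vec_eq_iff)
  have sumJ: "(\<Sum>i\<in>lab ` {1..J}. axis i 1) = (\<Sum>j=1..J. e j)"
    by (simp add: sum.reindex[OF injJ] e_def del: One_nat_def)
  have sumJ': "(\<Sum>i\<in>lab ` {J + 1..N}. axis i 1) = (\<Sum>j=J + 1..N. e j)"
    by (simp add: sum.reindex[OF injJ'] e_def del: One_nat_def)
  show "eigenvalue_with_eigenspace A 0 (span {vec 1})" if "2 * J < N"
  proof -
    have "eigenspace A 0 = span {vec 1}"
      unfolding A_def by (rule eigenspace_0) (use that in \<open>simp only: card; simp add: N_def\<close>)
    then show ?thesis
      by (rule eigenvalue_with_eigenspaceI[OF _ span_base vec1]) simp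
  qed
  let ?u = "vec 1 - (real N / real J) *\<^sub>R (\<Sum>j=1..J. e j)"
  have EK: "eigenspace A K = span {?u}"
    using eigenspace_K J unfolding card sumJ by (simp add: A_def N_def)
  have u_nth: "?u $ lab 1 = 1 - real N / real J"
  proof -
    have "lab 1 \<in> lab ` {1..J}" using J by auto
    then have "(\<Sum>i\<in>lab ` {1..J}. axis i (1::real)) $ lab 1 = 1" by (simp add: axis_def)
    then show ?thesis unfolding sumJ by simp
  qed
  \<comment> \<open>The quotient is at least 2, so the coordinate of \<open>?u\<close> at
    \<open>lab 1\<close> is nonzero.\<close>
  have "real N / real J \<noteq> 1" using J by auto
  have u: "?u \<noteq> 0"
  proof
    assume "?u = 0"
    then have "?u $ lab 1 = 0" by (simp only: zero_index)
    with u_nth \<open>real N / real J \<noteq> 1\<close> show False by linarith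
  qed
  show main_K: "eigenvalue_with_eigenspace A K (span {?u})"
    using EK by (rule eigenvalue_with_eigenspaceI[OF _ span_base u]) simp
  show "eigenvalue_with_eigenspace A (K * ((real N - 2 * real J) / real N))
        (span ((\<lambda>j. e j - e 1) ` {2..J}))" if "2 \<le> J" "2 * J < N"
  proof (rule eigenvalue_with_eigenspaceI[OF _ span_base])
    show "eigenspace A (K * ((real N - 2 * real J) / real N)) = span ((\<lambda>j. e j - e 1) ` {2..J})"
      using eigenspace_flipped that span_axis_differences_interval[OF injJ]
      unfolding card by (simp add: A_def N_def e_def numeral_2_eq_2)
    show "e 2 - e 1 \<in> (\<lambda>j. e j - e 1) ` {2..J}" using that by auto
    show "e 2 - e 1 \<noteq> 0"
      unfolding e_def by (rule axis_difference_nonzero[OF injJ]) (use that in auto)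
  qed
  show "eigenvalue_with_eigenspace A (K * ((2 * real J - real N) / real N))
        (span ((\<lambda>j. e j - e (J + 1)) ` {J + 2..N}))" if "2 * J < N" "J + 2 \<le> N"
  proof (rule eigenvalue_with_eigenspaceI[OF _ span_base])
    have "lab (J + 1) \<in> - (lab ` {1..J})"
      unfolding compl using that by (intro imageI) simp
    then have "lab ` {1..J} \<noteq> UNIV" by blast
    then have "eigenspace A (K * (- (real N - 2 * real J) / real N)) =
        {v. (\<forall>i\<in>lab ` {1..J}. v $ i = 0) \<and> sum (($) v) (- (lab ` {1..J})) = 0}"
      using eigenspace_unflipped that unfolding card by (simp add: A_def N_def)
    also have "\<dots> = {v. (\<forall>i. i \<notin> - (lab ` {1..J}) \<longrightarrow> v $ i = 0) \<and>
        sum (($) v) (- (lab ` {1..J})) = 0}" by auto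
    also have "\<dots> = span ((\<lambda>j. e j - e (J + 1)) ` {J + 2..N})"
      unfolding compl using span_axis_differences_interval[OF injJ'] that by (simp add: e_def)
    finally show "eigenspace A (K * ((2 * real J - real N) / real N)) =
        span ((\<lambda>j. e j - e (J + 1)) ` {J + 2..N})" by simp
    show "e (J + 2) - e (J + 1) \<in> (\<lambda>j. e j - e (J + 1)) ` {J + 2..N}" using that by auto
    show "e (J + 2) - e (J + 1) \<noteq> 0"
      unfolding e_def by (rule axis_difference_nonzero[OF injJ']) (use that in auto)
  qed
  show "eigenvalue_with_eigenspace A 0
      (span ((\<lambda>j. e j - e 1) ` {2..J} \<union> (\<lambda>j. e j + e 1) ` {J + 1..N}))" if "2 * J = N"
  proof (rule eigenvalue_with_eigenspaceI[OF _ _ vec1])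
    \<comment> \<open>Weight 1 on the block gives the differences \<open>e j - e 1\<close> and
      weight -1 off it the sums \<open>e j + e 1\<close>, with \<open>lab 1\<close> as common
      pivot.\<close>
    let ?B = "lab ` {1..J}" and ?w = "\<lambda>i. - phase_sign (lab ` {1..J}) i"
    let ?T = "(\<lambda>j. e j - e 1) ` {2..J} \<union> (\<lambda>j. e j + e 1) ` {J + 1..N}"
    have "lab 1 \<in> ?B" using J by auto
    then have phase_a: "phase_sign ?B (lab 1) = - 1" by (simp only: phase_sign_def if_True)
    have "(\<lambda>j. e j - e 1) ` {2..J} = (\<lambda>i. axis i 1 - ?w i *\<^sub>R axis (lab 1) 1) ` lab ` {2..J}"
      unfolding image_image by (intro image_cong) (auto simp: phase_sign_def e_def)
    moreover have "(\<lambda>j. e j + e 1) ` {J + 1..N} =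
        (\<lambda>i. axis i 1 - ?w i *\<^sub>R axis (lab 1) 1) ` lab ` {J + 1..N}"
      unfolding image_image
    proof (intro image_cong refl)
      fix j assume "j \<in> {J + 1..N}"
      then have "lab j \<notin> ?B" using compl by blast
      then show "e j + e 1 = axis (lab j) 1 - ?w (lab j) *\<^sub>R axis (lab 1) 1"
        by (simp add: phase_sign_def e_def)
    qed
    ultimately have "?T = (\<lambda>i. axis i 1 - ?w i *\<^sub>R axis (lab 1) 1) ` lab ` ({2..J} \<union> {J + 1..N})"
      by (simp add: image_Un)
    also have "lab ` ({2..J} \<union> {J + 1..N}) = UNIV - {lab 1}"
    proof -
      have "{2..J} \<union> {J + 1..N} = {1..N} - {1}" using J by auto
      then show ?thesis
        using inj_on_image_set_diff[OF inj, of "{1..N}" "{1}"] J lab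
        by (simp add: bij_betw_def N_def)
    qed
    finally have "span ?T =
        {v. (\<forall>i. i \<notin> insert (lab 1) (UNIV - {lab 1}) \<longrightarrow> v $ i = 0) \<and>
          v $ lab 1 + (\<Sum>i\<in>UNIV - {lab 1}. ?w i * v $ i) = 0}"
      using span_axis_differences[of "lab 1" "UNIV - {lab 1}" ?w] by simp
    \<comment> \<open>The pivot has sign -1 and coefficient 1, so the hyperplane equation is
      \<open>s \<bullet> v = 0\<close> up to a global sign.\<close>
    also have "\<dots> = {v. (\<Sum>i\<in>UNIV. phase_sign ?B i * v $ i) = 0}"
    proof -
      have "(\<Sum>i\<in>UNIV. phase_sign ?B i * v $ i) =
          - (v $ lab 1 + (\<Sum>i\<in>UNIV - {lab 1}. ?w i * v $ i))" for v
        using phase_a by (subst sum.remove[of _ "lab 1"]) (simp_all add: sum_negf)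
      then show ?thesis by (simp only: neg_equal_0_iff_equal) simp
    qed
    also have "\<dots> = eigenspace A 0"
      using eigenspace_0_balanced that unfolding card
      by (simp add: A_def N_def sum_phase_sign_mult flip: of_nat_mult)
    finally show E0: "eigenspace A 0 = span ?T" by simp
    show "vec 1 \<in> span ?T"
      unfolding E0[symmetric] A_def by (rule vec_1_mem_eigenspace_0)
  qed
  show "eigenvalue_with_eigenspace A K
      (span {- (\<Sum>j=1..J. e j) + (\<Sum>j=J + 1..N. e j)})" if "2 * J = N"
  proof -
    \<comment> \<open>With this ratio \<open>?u\<close> is the sum of all basis vectors minus twice
      those of the first block.\<close>
    have "real N / real J = 2" using that J by (auto simp flip: that)
    moreover have "vec 1 = (\<Sum>j=1..J. e j) + (\<Sum>j=J + 1..N. e j)"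
    proof -
      have "vec 1 $ i = (\<Sum>i\<in>UNIV. axis i (1::real)) $ i" for i :: 'n
        by (simp add: axis_def)
      then have "vec 1 = (\<Sum>i\<in>UNIV. axis i (1::real) :: real ^ 'n)"
        by (simp add: vec_eq_iff)
      also have "\<dots> = (\<Sum>i\<in>lab ` {1..J}. axis i 1) + (\<Sum>i\<in>- (lab ` {1..J}). axis i 1)"
        by (subst sum.union_disjoint[symmetric]) auto
      finally show ?thesis by (simp only: compl sumJ sumJ')
    qed
    ultimately have "?u = - (\<Sum>j=1..J. e j) + (\<Sum>j=J + 1..N. e j)"
      by (simp add: scaleR_2)
    with main_K show ?thesis by simp
  qed
qed

text \<open>The guards \<open>N \<ge> 2\<close> and \<open>N \<ge> 3\<close> exclude empty families
  of differences, whose span is zero and cannot be the eigenspace of an eigenvalue.\<close>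

theorem proposition2p2:
  fixes K :: real and N :: nat and lab :: "nat \<Rightarrow> 'n::finite"
    and e :: "nat \<Rightarrow> real ^ 'n" and DV :: "real ^ 'n \<Rightarrow> real ^ 'n ^ 'n"
  assumes K: "K > 0"
    and N: "N = CARD('n)"
    and lab: "bij_betw lab {1..N} UNIV"
    and e: "\<And>j. e j = axis (lab j) 1"
    and DV: "\<And>\<theta>. DV \<theta> = jacobian (kuramoto K) (at \<theta>)"
  shows
    "(\<forall>\<theta>. coherent \<theta> \<longrightarrow>
        eigenvalue_with_eigenspace (DV \<theta>) 0 (span {vec 1}) \<and>
        (N \<ge> 2 \<longrightarrow>
          eigenvalue_with_eigenspace (DV \<theta>) (- K) (span ((\<lambda>j. e j - e 1) ` {2..N})))) \<and>
     (\<forall>\<theta>. partially_coherent lab 1 \<theta> \<longrightarrow>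
        eigenvalue_with_eigenspace (DV \<theta>) 0 (span {vec 1}) \<and>
        eigenvalue_with_eigenspace (DV \<theta>) K (span {vec 1 - real N *\<^sub>R e 1}) \<and>
        (N \<ge> 3 \<longrightarrow>
          eigenvalue_with_eigenspace (DV \<theta>) (K * ((2 - real N) / real N))
            (span ((\<lambda>j. e j - e 2) ` {3..N})))) \<and>
     (\<forall>\<theta> J. partially_coherent lab J \<theta> \<and>
             J \<in> (if odd N then {2..N div 2} else {2..N div 2 - 1}) \<longrightarrow>
        eigenvalue_with_eigenspace (DV \<theta>) 0 (span {vec 1}) \<and>
        eigenvalue_with_eigenspace (DV \<theta>) K
          (span {vec 1 - (real N / real J) *\<^sub>R (\<Sum>j=1..J. e j)}) \<and>
        eigenvalue_with_eigenspace (DV \<theta>) (K * ((real N - 2 * real J) / real N))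
          (span ((\<lambda>j. e j - e 1) ` {2..J})) \<and>
        eigenvalue_with_eigenspace (DV \<theta>) (K * ((2 * real J - real N) / real N))
          (span ((\<lambda>j. e j - e (J + 1)) ` {J + 2..N}))) \<and>
     (\<forall>\<theta>. even N \<and> partially_coherent lab (N div 2) \<theta> \<longrightarrow>
        eigenvalue_with_eigenspace (DV \<theta>) 0
          (span ((\<lambda>j. e j - e 1) ` {2..N div 2} \<union> (\<lambda>j. e j + e 1) ` {N div 2 + 1..N})) \<and>
        eigenvalue_with_eigenspace (DV \<theta>) K
          (span {- (\<Sum>j=1..N div 2. e j) + (\<Sum>j=N div 2 + 1..N. e j)})) \<and>
     (\<forall>\<theta>. incoherent \<theta> \<and> (\<exists>i0 i1. \<forall>k::int. \<theta> $ i0 - \<theta> $ i1 \<noteq> of_int k * pi) \<longrightarrow>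
        (let r = cmod (\<Sum>j\<in>UNIV. exp (2 * \<i> * complex_of_real (\<theta> $ j)));
             l2 = K / 2 * (1 + 1 / real N * r);
             l3 = K / 2 * (1 - 1 / real N * r)
         in eigenvalue (DV \<theta>) 0 \<and> dim (eigenspace (DV \<theta>) 0) + 2 = N \<and>
            eigenvalue (DV \<theta>) l2 \<and> eigenvalue (DV \<theta>) l3 \<and>
            (l2 \<noteq> l3 \<longrightarrow>
               dim (eigenspace (DV \<theta>) l2) = 1 \<and> dim (eigenspace (DV \<theta>) l3) = 1) \<and>
            (l2 = l3 \<longrightarrow> dim (eigenspace (DV \<theta>) l2) = 2)))"
proof (intro conjI allI impI; (elim conjE exE)?)
  note lab' = lab[unfolded N]
  fix \<theta> :: "real ^ 'n" assume "coherent \<theta>"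
  note * = coherent_spectrum[OF K lab' this]
  show "eigenvalue_with_eigenspace (DV \<theta>) 0 (span {vec 1})"
    using *(1) by (simp add: DV)
  show "eigenvalue_with_eigenspace (DV \<theta>) (- K) (span ((\<lambda>j. e j - e 1) ` {2..N}))" if "N \<ge> 2"
    using *(2) that by (simp add: DV e N)
next
  note lab' = lab[unfolded N]
  fix \<theta> :: "real ^ 'n" assume pc: "partially_coherent lab 1 \<theta>"
  note pc_facts = K lab' pc
  have "1 \<le> N div 2" using pc by (simp add: partially_coherent_def N)
  then have N2: "N \<ge> 2" by linarith
  \<comment> \<open>Two oscillators with \<open>J = 1\<close> are balanced, so
    \<open>2 * J < N\<close> fails; the balanced kernel then has the single generator
    \<open>e 2 + e 1\<close>, the constant vector.\<close>
  show "eigenvalue_with_eigenspace (DV \<theta>) 0 (span {vec 1})"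
  proof (cases "N = 2")
    case True
    then have "eigenvalue_with_eigenspace (DV \<theta>) 0 (span {e 2 + e 1})"
      using partially_coherent_balanced_0[OF pc_facts] N by (simp add: DV e del: One_nat_def)
    moreover have "e 2 + e 1 = vec 1"
    proof -
      have "(UNIV :: 'n set) = {lab 1, lab 2}" "lab 1 \<noteq> lab 2"
        using lab True by (auto simp: bij_betw_def atLeastAtMost_insertL[symmetric] numeral_2_eq_2
            atLeastAtMostSuc_conv inj_on_def)
      then show ?thesis by (auto simp: vec_eq_iff e axis_def)
    qed
    ultimately show ?thesis by simp
  next
    case False
    then show ?thesis using partially_coherent_0[OF pc_facts] N2 N by (simp add: DV)
  qed
  show "eigenvalue_with_eigenspace (DV \<theta>) K (span {vec 1 - real N *\<^sub>R e 1})"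
    using partially_coherent_K[OF pc_facts] by (simp add: DV e N)
  show "eigenvalue_with_eigenspace (DV \<theta>) (K * ((2 - real N) / real N))
      (span ((\<lambda>j. e j - e 2) ` {3..N}))" if "N \<ge> 3"
    using partially_coherent_unflipped[OF pc_facts] that
    by (simp add: DV e N numeral_2_eq_2 numeral_3_eq_3)
next
  note lab' = lab[unfolded N]
  fix \<theta> :: "real ^ 'n" and J
  assume pc: "partially_coherent lab J \<theta>"
    and J: "J \<in> (if odd N then {2..N div 2} else {2..N div 2 - 1})"
  note pc_facts = K lab' pc
  \<comment> \<open>Both ranges of \<open>J\<close> amount to \<open>2 * J < N\<close>: for odd
    \<open>N\<close> the floor excludes equality, for even \<open>N\<close> the subtracted 1
    does.\<close>
  have J2: "2 \<le> J" and JN: "2 * J < CARD('n)"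
    using J unfolding N[symmetric] by (auto split: if_splits elim!: oddE evenE)
  show "eigenvalue_with_eigenspace (DV \<theta>) 0 (span {vec 1})"
    using partially_coherent_0[OF pc_facts JN] by (simp add: DV)
  show "eigenvalue_with_eigenspace (DV \<theta>) K
      (span {vec 1 - (real N / real J) *\<^sub>R (\<Sum>j=1..J. e j)})"
    using partially_coherent_K[OF pc_facts] by (simp add: DV e N)
  show "eigenvalue_with_eigenspace (DV \<theta>) (K * ((real N - 2 * real J) / real N))
      (span ((\<lambda>j. e j - e 1) ` {2..J}))"
    using partially_coherent_flipped[OF pc_facts J2 JN] by (simp add: DV e N)
  \<comment> \<open>The bound \<open>J + 2 \<le> N\<close> follows from
    \<open>J + 2 \<le> 2 * J\<close> and \<open>2 * J < N\<close>.\<close>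
  show "eigenvalue_with_eigenspace (DV \<theta>) (K * ((2 * real J - real N) / real N))
      (span ((\<lambda>j. e j - e (J + 1)) ` {J + 2..N}))"
    using partially_coherent_unflipped[OF pc_facts JN] J2 JN by (simp add: DV e N)
next
  note lab' = lab[unfolded N]
  fix \<theta> :: "real ^ 'n" assume "even N" and pc: "partially_coherent lab (N div 2) \<theta>"
  then have half: "2 * (N div 2) = CARD('n)" by (simp add: N)
  show "eigenvalue_with_eigenspace (DV \<theta>) 0
      (span ((\<lambda>j. e j - e 1) ` {2..N div 2} \<union> (\<lambda>j. e j + e 1) ` {N div 2 + 1..N}))"
    using partially_coherent_balanced_0[OF K lab' pc half] by (simp add: DV e N)
  show "eigenvalue_with_eigenspace (DV \<theta>) K
      (span {- (\<Sum>j=1..N div 2. e j) + (\<Sum>j=N div 2 + 1..N. e j)})"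
    using partially_coherent_balanced_K[OF K lab' pc half] by (simp add: DV e N)
next
  fix \<theta> :: "real ^ 'n" and i0 i1
  assume "incoherent \<theta>" "\<forall>k::int. \<theta> $ i0 - \<theta> $ i1 \<noteq> of_int k * pi"
  from incoherent_spectrum[OF K this]
  show "let r = cmod (\<Sum>j\<in>UNIV. exp (2 * \<i> * complex_of_real (\<theta> $ j)));
            l2 = K / 2 * (1 + 1 / real N * r);
            l3 = K / 2 * (1 - 1 / real N * r)
        in eigenvalue (DV \<theta>) 0 \<and> dim (eigenspace (DV \<theta>) 0) + 2 = N \<and>
           eigenvalue (DV \<theta>) l2 \<and> eigenvalue (DV \<theta>) l3 \<and>
           (l2 \<noteq> l3 \<longrightarrow>
              dim (eigenspace (DV \<theta>) l2) = 1 \<and> dim (eigenspace (DV \<theta>) l3) = 1) \<and>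
           (l2 = l3 \<longrightarrow> dim (eigenspace (DV \<theta>) l2) = 2)"
    unfolding Let_def DV N .
qed

end
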